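(* Suppose that $\sup_{z_1,z_2\in Z}V(z_1,z_2)\le\Omega_Z^2$. Suppose the parameters $\{\alpha_t\}_{t\ge1}$ and $\{\gamma_t\}_{t\ge1}$ (with $\gamma_t>0$) of the AMP method are chosen such that $\alpha_1=1$, $0\le\alpha_t<1$ for all $t>1$, and for all $t\ge1$ $$\mu-L_G\alpha_t\gamma_t-\frac{L_H^2\gamma_t^2}{\mu}\ge0\qquad\text{and}\qquad\frac{\alpha_t}{\Gamma_t\gamma_t}\le\frac{\alpha_{t+1}}{\Gamma_{t+1}\gamma_{t+1}},$$ where $\Gamma_1=1$ and $\Gamma_t=(1-\alpha_t)\Gamma_{t-1}$ for $t>1$. Then for all $t\ge1$ the iterates of the AMP method satisfy $$g(w^{ag}_{t+1})\le\frac{\alpha_t}{\gamma_t}\Omega_Z^2 .$$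
   Context: Setting. $\mathcal E$ is a finite-dimensional real vector space with inner product $\langle\cdot,\cdot\rangle$ and a norm $\|\cdot\|$, with dual norm $\|\eta\|_*=\sup_{\|x\|\le1}\langle\eta,x\rangle$; $Z\subset\mathcal E$ is a nonempty closed convex set. $G$ is continuously differentiable with $0\le G(w)-G(v)-\langle\nabla G(w')|_{w'=v},w-v\rangle\le\frac{L_G}{2}\|w-v\|^2$ for all $w,v\in Z$, i.e. (with $\nabla G(v)$ the gradient at $v$) $0\le G(w)-G(v)-\langle\nabla G(v),w-v\rangle\le\frac{L_G}{2}\|w-v\|^2$. $H:Z\to\mathcal E$ satisfies $\langle H(w)-H(v),w-v\rangle\ge0$ and $\|H(w)-H(v)\|_*\le L_H\|w-v\|$ for all $w,v\in Z$. $J$ is a real-valued convex function on $Z$ having a subgradient $J'(u)\in\partial J(u)$ at each $u\in Z$. Prox-mapping. $\omega$ is a differentiable strongly convex function on $Z$ with convexity parameter $\mu>0$ with respect to $\|\cdot\|$; $V(z,u)=\omega(u)-\omega(z)-\langle\nabla\omega(z),u-z\rangle$ for $u,z\in Z$. For $z\in Z$, $\eta\in\mathcal E$, $\gamma>0$, $P_z^{\gamma J}(\eta)=\operatorname{argmin}_{u\in Z}\{\langle\eta,u-z\rangle+V(z,u)+\gamma J(u)\}$, assumed to be well defined. AMP method. Choose $r_1\in Z$ and set $w_1=w_1^{ag}=r_1$. For $t=1,2,\ldots$: $w_t^{md}=(1-\alpha_t)w_t^{ag}+\alpha_tr_t$; $w_{t+1}=P_{r_t}^{\gamma_tJ}(\gamma_tH(r_t)+\gamma_t\nabla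 G(w_t^{md}))$; $r_{t+1}=P_{r_t}^{\gamma_tJ}(\gamma_tH(w_{t+1})+\gamma_t\nabla G(w_t^{md}))$; $w_{t+1}^{ag}=(1-\alpha_t)w_t^{ag}+\alpha_tw_{t+1}$. Gap function. $Q(\tilde u,u)=G(\tilde u)-G(u)+\langle H(u),\tilde u-u\rangle+J(\tilde u)-J(u)$ for $\tilde u,u\in Z$, and $g(\tilde u)=\sup_{u\in Z}Q(\tilde u,u)$. *)

theory Defs
  imports "HOL-Analysis.Analysis"
begin

text \<open>
  The space is a type of class \<open>euclidean_space\<close>, whose \<open>norm\<close> is the one induced by the inner
  product.  The norm of the setting need not be that one, so it is a function \<open>N\<close> of its own.
\<close>

definition is_norm :: "('a::real_vector \<Rightarrow> real) \<Rightarrow> bool" where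
  "is_norm N \<longleftrightarrow>
     (\<forall>x. 0 \<le> N x) \<and> (\<forall>x. N x = 0 \<longleftrightarrow> x = 0) \<and>
     (\<forall>a x. N (a *\<^sub>R x) = \<bar>a\<bar> * N x) \<and> (\<forall>x y. N (x + y) \<le> N x + N y)"

text \<open>The supremum is over a nonempty bounded set of reals when \<open>N\<close> is a norm and the dimension is finite.\<close>

definition dual_norm :: "('a::euclidean_space \<Rightarrow> real) \<Rightarrow> 'a \<Rightarrow> real" where
  "dual_norm N \<eta> = (SUP x\<in>{x. N x \<le> 1}. \<eta> \<bullet> x)"

text \<open>
  The derivative is taken within \<open>Z\<close>, since the functions are only given on \<open>Z\<close>, which may have
  empty interior.  There \<open>f'\<close> need not be unique, but for convex \<open>Z\<close> the numbers \<open>f' z \<bullet> (u - z)\<close>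
  with \<open>z, u \<in> Z\<close>, and hence \<open>f' z \<bullet> (u - v)\<close> with \<open>z, u, v \<in> Z\<close>, are.  If \<open>f\<close> is differentiable
  on a neighbourhood of \<open>Z\<close>, its ordinary gradient qualifies.
\<close>

definition has_gradient_on ::
  "('a::euclidean_space \<Rightarrow> real) \<Rightarrow> ('a \<Rightarrow> 'a) \<Rightarrow> 'a set \<Rightarrow> bool" where
  "has_gradient_on f f' Z \<longleftrightarrow> (\<forall>z\<in>Z. (f has_derivative (\<lambda>h. f' z \<bullet> h)) (at z within Z))"

definition strongly_convex_on ::
  "('a::real_vector \<Rightarrow> real) \<Rightarrow> real \<Rightarrow> 'a set \<Rightarrow> ('a \<Rightarrow> real) \<Rightarrow> bool" where
  "strongly_convex_on N \<mu> Z f \<longleftrightarrow> convex Z \<and>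
     (\<forall>x\<in>Z. \<forall>y\<in>Z. \<forall>s\<in>{0..1}.
        f ((1 - s) *\<^sub>R x + s *\<^sub>R y)
          \<le> (1 - s) * f x + s * f y - \<mu> / 2 * s * (1 - s) * (N (x - y))\<^sup>2)"

definition subdifferential :: "'a::real_inner set \<Rightarrow> ('a \<Rightarrow> real) \<Rightarrow> 'a \<Rightarrow> 'a set" where
  "subdifferential Z J u = {\<xi>. \<forall>v\<in>Z. J u + \<xi> \<bullet> (v - u) \<le> J v}"

definition bregman ::
  "('a::real_inner \<Rightarrow> real) \<Rightarrow> ('a \<Rightarrow> 'a) \<Rightarrow> 'a \<Rightarrow> 'a \<Rightarrow> real" where
  "bregman \<omega> \<omega>' z u = \<omega> u - \<omega> z - \<omega>' z \<bullet> (u - z)"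

definition prox_objective ::
  "('a::real_inner \<Rightarrow> real) \<Rightarrow> ('a \<Rightarrow> 'a) \<Rightarrow> ('a \<Rightarrow> real) \<Rightarrow> real \<Rightarrow> 'a \<Rightarrow> 'a \<Rightarrow> 'a \<Rightarrow> real" where
  "prox_objective \<omega> \<omega>' J \<gamma> z \<eta> u = \<eta> \<bullet> (u - z) + bregman \<omega> \<omega>' z u + \<gamma> * J u"

definition prox ::
  "'a::real_inner set \<Rightarrow> ('a \<Rightarrow> real) \<Rightarrow> ('a \<Rightarrow> 'a) \<Rightarrow> ('a \<Rightarrow> real) \<Rightarrow> real \<Rightarrow> 'a \<Rightarrow> 'a \<Rightarrow> 'a" where
  "prox Z \<omega> \<omega>' J \<gamma> z \<eta> = arg_min (prox_objective \<omega> \<omega>' J \<gamma> z \<eta>) (\<lambda>u. u \<in> Z)"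

definition prox_well_defined ::
  "'a::real_inner set \<Rightarrow> ('a \<Rightarrow> real) \<Rightarrow> ('a \<Rightarrow> 'a) \<Rightarrow> ('a \<Rightarrow> real) \<Rightarrow> bool" where
  "prox_well_defined Z \<omega> \<omega>' J \<longleftrightarrow>
     (\<forall>z\<in>Z. \<forall>\<eta>. \<forall>\<gamma>>0. \<exists>!u. is_arg_min (prox_objective \<omega> \<omega>' J \<gamma> z \<eta>) (\<lambda>u. u \<in> Z) u)"

text \<open>All sequences are indexed from \<open>1\<close>; their values at \<open>0\<close> are irrelevant.\<close>

definition amp_iterates ::
  "'a::real_inner set \<Rightarrow> ('a \<Rightarrow> 'a) \<Rightarrow> ('a \<Rightarrow> 'a) \<Rightarrow> ('a \<Rightarrow> real) \<Rightarrow> ('a \<Rightarrow> real) \<Rightarrow> ('a \<Rightarrow> 'a) \<Rightarrow>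
   (nat \<Rightarrow> real) \<Rightarrow> (nat \<Rightarrow> real) \<Rightarrow>
   (nat \<Rightarrow> 'a) \<Rightarrow> (nat \<Rightarrow> 'a) \<Rightarrow> (nat \<Rightarrow> 'a) \<Rightarrow> (nat \<Rightarrow> 'a) \<Rightarrow> bool" where
  "amp_iterates Z G' H J \<omega> \<omega>' \<alpha> \<gamma> r w w_ag w_md \<longleftrightarrow>
     r 1 \<in> Z \<and> w 1 = r 1 \<and> w_ag 1 = r 1 \<and>
     (\<forall>t\<ge>1.
        w_md t = (1 - \<alpha> t) *\<^sub>R w_ag t + \<alpha> t *\<^sub>R r t \<and>
        w (t + 1) = prox Z \<omega> \<omega>' J (\<gamma> t) (r t) (\<gamma> t *\<^sub>R H (r t) + \<gamma> t *\<^sub>R G' (w_md t)) \<and>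
        r (t + 1) = prox Z \<omega> \<omega>' J (\<gamma> t) (r t) (\<gamma> t *\<^sub>R H (w (t + 1)) + \<gamma> t *\<^sub>R G' (w_md t)) \<and>
        w_ag (t + 1) = (1 - \<alpha> t) *\<^sub>R w_ag t + \<alpha> t *\<^sub>R w (t + 1))"

definition gap_Q ::
  "('a::real_inner \<Rightarrow> real) \<Rightarrow> ('a \<Rightarrow> 'a) \<Rightarrow> ('a \<Rightarrow> real) \<Rightarrow> 'a \<Rightarrow> 'a \<Rightarrow> real" where
  "gap_Q G H J v u = G v - G u + H u \<bullet> (v - u) + J v - J u"

text \<open>Extended-real valued, as the supremum may be infinite.\<close>

definition gap ::
  "'a::real_inner set \<Rightarrow> ('a \<Rightarrow> real) \<Rightarrow> ('a \<Rightarrow> 'a) \<Rightarrow> ('a \<Rightarrow> real) \<Rightarrow> 'a \<Rightarrow> ereal" where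
  "gap Z G H J v = (SUP u\<in>Z. ereal (gap_Q G H J v u))"

end

theory Submission
  imports Defs
begin

text \<open>
  The optimality conditions of the two prox-steps, added up, bound
  \<open>\<gamma>\<^sub>t \<langle>H(w\<^sub>t\<^sub>+\<^sub>1) + \<nabla>G(w\<^sub>t\<^sup>m\<^sup>d), w\<^sub>t\<^sub>+\<^sub>1 - u\<rangle> + \<gamma>\<^sub>t (J(w\<^sub>t\<^sub>+\<^sub>1) - J(u))\<close> by
  \<open>V(r\<^sub>t, u) - V(r\<^sub>t\<^sub>+\<^sub>1, u)\<close> minus a multiple of \<open>\<parallel>w\<^sub>t\<^sub>+\<^sub>1 - r\<^sub>t\<parallel>\<^sup>2\<close>: the error made by evaluating \<open>H\<close> at
  \<open>r\<^sub>t\<close> is absorbed by the strong convexity of \<open>\<omega>\<close>.  The step-size condition makes that multiple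
  pay for the smoothness error of \<open>G\<close>, which gives
  \<open>Q(w\<^sup>a\<^sup>g\<^sub>t\<^sub>+\<^sub>1, u) \<le> (1 - \<alpha>\<^sub>t) Q(w\<^sup>a\<^sup>g\<^sub>t, u) + \<alpha>\<^sub>t / \<gamma>\<^sub>t (V(r\<^sub>t, u) - V(r\<^sub>t\<^sub>+\<^sub>1, u))\<close>.
  Divide by \<open>\<Gamma>\<^sub>t\<close> and sum; the weights \<open>\<alpha>\<^sub>t / (\<Gamma>\<^sub>t \<gamma>\<^sub>t)\<close> increase and \<open>V \<le> \<Omega>\<^sup>2\<close>, so the sum is at most
  \<open>\<alpha>\<^sub>t / (\<Gamma>\<^sub>t \<gamma>\<^sub>t) \<Omega>\<^sup>2\<close>.
\<close>

section \<open>Norm comparison and the duality inequality\<close>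

text \<open>A convex function on the whole space is continuous, so \<open>N\<close> attains a
  positive minimum on the compact Euclidean unit sphere; homogeneity does the rest. This makes the
  unit ball of \<open>N\<close> bounded.\<close>

lemma is_norm_lower_bound:
  fixes N :: "'a::euclidean_space \<Rightarrow> real"
  assumes "is_norm N"
  obtains c where "0 < c" "\<And>x. c * norm x \<le> N x"
proof -
  have nn: "0 \<le> N x" and z: "N x = 0 \<longleftrightarrow> x = 0" and sc: "N (a *\<^sub>R x) = \<bar>a\<bar> * N x"
    and tri: "N (x + y) \<le> N x + N y" for a x y
    using assms unfolding is_norm_def by auto
  have "convex_on UNIV N"
  proof (rule convex_onI)
    fix t :: real and x y :: 'a
    assume "0 < t" "t < 1"
    then show "N ((1 - t) *\<^sub>R x + t *\<^sub>R y) \<le> (1 - t) * N x + t * N y"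
      using tri[of "(1 - t) *\<^sub>R x" "t *\<^sub>R y"] by (simp add: sc)
  qed simp
  then have "continuous_on UNIV N"
    by (rule convex_on_continuous[OF open_UNIV])
  then have "continuous_on (sphere 0 1) N"
    using continuous_on_subset by blast
  moreover have "sphere (0::'a) 1 \<noteq> {}"
    by simp
  ultimately obtain p where p: "p \<in> sphere 0 1" "\<And>y. y \<in> sphere 0 1 \<Longrightarrow> N p \<le> N y"
    using continuous_attains_inf[OF compact_sphere] by metis
  have "p \<noteq> 0"
    using p(1) by auto
  then have "0 < N p"
    using nn[of p] z[of p] by linarith
  moreover have "N p * norm x \<le> N x" for x
  proof (cases "x = 0")
    case False
    have "N p \<le> N ((1 / norm x) *\<^sub>R x)"
      by (rule p(2)) (use False in simp)
    then show ?thesis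
      using False by (simp add: sc field_simps)
  qed (simp add: nn)
  ultimately show ?thesis
    using that by blast
qed

lemma inner_le_dual_norm:
  fixes N :: "'a::euclidean_space \<Rightarrow> real"
  assumes "is_norm N"
  shows "\<eta> \<bullet> x \<le> dual_norm N \<eta> * N x"
proof -
  have nn: "0 \<le> N x" and z: "N x = 0 \<longleftrightarrow> x = 0" and sc: "N (a *\<^sub>R x) = \<bar>a\<bar> * N x" for a x
    using assms unfolding is_norm_def by auto
  obtain c where c: "0 < c" "\<And>x. c * norm x \<le> N x"
    using is_norm_lower_bound[OF assms] by blast
  \<comment> \<open>The real-valued \<open>SUP\<close> in \<open>dual_norm\<close> is known to be an
    upper bound only once the set is bounded above; Cauchy-Schwarz on the bounded unit ball of
    \<open>N\<close> supplies this.\<close>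
  have "bdd_above ((\<bullet>) \<eta> ` {x. N x \<le> 1})"
  proof (rule bdd_aboveI2)
    fix y assume "y \<in> {x. N x \<le> 1}"
    then have "norm y \<le> 1 / c"
      using c(1) c(2)[of y] by (simp add: field_simps)
    have "\<eta> \<bullet> y \<le> norm \<eta> * norm y"
      by (rule norm_cauchy_schwarz)
    also have "\<dots> \<le> norm \<eta> * (1 / c)"
      using \<open>norm y \<le> 1 / c\<close> by (rule mult_left_mono) simp
    finally show "\<eta> \<bullet> y \<le> norm \<eta> * (1 / c)" .
  qed
  then have ub: "\<eta> \<bullet> y \<le> dual_norm N \<eta>" if "N y \<le> 1" for y
    unfolding dual_norm_def using that by (intro cSUP_upper) auto
  show ?thesis
  proof (cases "x = 0")
    case False
    then have pos: "0 < N x"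
      using nn[of x] z[of x] by linarith
    then have "\<eta> \<bullet> ((1 / N x) *\<^sub>R x) \<le> dual_norm N \<eta>"
      by (intro ub) (simp add: sc)
    then show ?thesis
      using pos by (simp add: field_simps)
  qed (use z[of 0] in simp)
qed

section \<open>Derivatives along segments and the Bregman distance\<close>

text \<open>Chain rule along a segment: convexity keeps it in \<open>Z\<close>, so the derivative
  within \<open>Z\<close> suffices even if \<open>Z\<close> has empty interior. It turns
  inequalities on segments into inequalities for gradients.\<close>

lemma has_gradient_on_tendsto_quotient:
  fixes f :: "'a::euclidean_space \<Rightarrow> real"
  assumes "has_gradient_on f f' Z" and "convex Z" and "x \<in> Z" and "u \<in> Z"
  shows "((\<lambda>s. (f ((1 - s) *\<^sub>R x + s *\<^sub>R u) - f x) / s) \<longlongrightarrow> f' x \<bullet> (u - x)) (at_right 0)"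
proof -
  let ?p = "\<lambda>s::real. (1 - s) *\<^sub>R x + s *\<^sub>R u"
  have p: "(?p has_derivative (\<lambda>s. s *\<^sub>R (u - x))) (at 0 within {0..1})"
    by (auto intro!: derivative_eq_intros simp: algebra_simps)
  have "?p ` {0..1} \<subseteq> Z"
    using assms(2-4) by (auto simp: convex_alt)
  moreover have "(f has_derivative (\<lambda>h. f' x \<bullet> h)) (at (?p 0) within Z)"
    using assms(1,3) by (simp add: has_gradient_on_def)
  ultimately have "((\<lambda>s. f (?p s)) has_derivative (\<lambda>s. f' x \<bullet> (s *\<^sub>R (u - x)))) (at 0 within {0..1})"
    using has_derivative_in_compose[OF p] has_derivative_subset by blast
  then have "((\<lambda>s. f (?p s)) has_field_derivative f' x \<bullet> (u - x)) (at 0 within {0..1})"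
    by (simp add: has_field_derivative_def mult.commute[of _ "f' x \<bullet> (u - x)"])
  then show ?thesis
    by (simp add: has_field_derivative_iff at_within_Icc_at_right)
qed

text \<open>Strong convexity bounds the difference quotient from \<open>z\<close> towards
  \<open>u\<close>; its factor \<open>1 - s\<close> disappears as \<open>s\<close> tends to
  0.\<close>

lemma bregman_lower_bound:
  fixes \<omega> :: "'a::euclidean_space \<Rightarrow> real"
  assumes "has_gradient_on \<omega> \<omega>' Z" and "strongly_convex_on N \<mu> Z \<omega>" and "z \<in> Z" and "u \<in> Z"
  shows "\<mu> / 2 * (N (z - u))\<^sup>2 \<le> bregman \<omega> \<omega>' z u"
proof -
  let ?b = "\<lambda>s. \<omega> u - \<omega> z - \<mu> / 2 * (1 - s) * (N (z - u))\<^sup>2"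
  have Z: "convex Z"
    using assms(2) by (simp add: strongly_convex_on_def)
  have "eventually (\<lambda>s. (\<omega> ((1 - s) *\<^sub>R z + s *\<^sub>R u) - \<omega> z) / s \<le> ?b s) (at_right 0)"
    unfolding eventually_at_right_field
  proof (intro exI[of _ 1] conjI allI impI)
    fix s :: real assume s: "0 < s" "s < 1"
    have "\<omega> ((1 - s) *\<^sub>R z + s *\<^sub>R u)
        \<le> (1 - s) * \<omega> z + s * \<omega> u - \<mu> / 2 * s * (1 - s) * (N (z - u))\<^sup>2"
      using assms(2-4) s unfolding strongly_convex_on_def by simp
    also have "\<dots> = \<omega> z + s * ?b s"
      by (simp add: algebra_simps)
    finally show "(\<omega> ((1 - s) *\<^sub>R z + s *\<^sub>R u) - \<omega> z) / s \<le> ?b s"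
      using s by (simp add: pos_divide_le_eq mult.commute)
  qed simp
  moreover have "(?b \<longlongrightarrow> \<omega> u - \<omega> z - \<mu> / 2 * (1 - 0) * (N (z - u))\<^sup>2) (at_right 0)"
    by (intro tendsto_intros)
  ultimately have "\<omega>' z \<bullet> (u - z) \<le> \<omega> u - \<omega> z - \<mu> / 2 * (1 - 0) * (N (z - u))\<^sup>2"
    using has_gradient_on_tendsto_quotient[OF assms(1) Z assms(3,4)]
    by (intro tendsto_le[OF trivial_limit_at_right_real])
  then show ?thesis
    by (simp add: bregman_def)
qed

section \<open>The prox-mapping\<close>

lemma prox_is_arg_min:
  assumes "prox_well_defined Z \<omega> \<omega>' J" and "z \<in> Z" and "0 < \<gamma>"
  shows "is_arg_min (prox_objective \<omega> \<omega>' J \<gamma> z \<eta>) (\<lambda>u. u \<in> Z) (prox Z \<omega> \<omega>' J \<gamma> z \<eta>)"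
  using assms unfolding prox_well_defined_def prox_def arg_min_def by (metis someI_ex)

lemma prox_in:
  assumes "prox_well_defined Z \<omega> \<omega>' J" and "z \<in> Z" and "0 < \<gamma>"
  shows "prox Z \<omega> \<omega>' J \<gamma> z \<eta> \<in> Z"
  using prox_is_arg_min[OF assms] by (simp add: is_arg_min_def)

text \<open>The minimiser \<open>p\<close> is compared with points moving from \<open>p\<close>
  towards \<open>u\<close>. Along the segment \<open>J\<close> is bounded by its chord, so only
  \<omega> is differentiated when \<open>s\<close> tends to 0.\<close>

lemma prox_optimality:
  fixes \<omega> :: "'a::euclidean_space \<Rightarrow> real"
  assumes "prox_well_defined Z \<omega> \<omega>' J" and "has_gradient_on \<omega> \<omega>' Z" and "convex_on Z J"
    and "z \<in> Z" and "0 < \<gamma>" and "u \<in> Z" and p_def: "p = prox Z \<omega> \<omega>' J \<gamma> z \<eta>"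
  shows "\<eta> \<bullet> (p - u) + \<gamma> * (J p - J u)
    \<le> bregman \<omega> \<omega>' z u - bregman \<omega> \<omega>' p u - bregman \<omega> \<omega>' z p"
proof -
  let ?x = "\<lambda>s. (1 - s) *\<^sub>R p + s *\<^sub>R u"
  let ?c = "(\<omega>' z - \<eta>) \<bullet> (u - p) - \<gamma> * (J u - J p)"
  have Z: "convex Z"
    using assms(3) by (rule convex_on_imp_convex)
  have pZ: "p \<in> Z"
    using prox_in[OF assms(1,4,5)] by (simp add: p_def)
  have min: "prox_objective \<omega> \<omega>' J \<gamma> z \<eta> p \<le> prox_objective \<omega> \<omega>' J \<gamma> z \<eta> y" if "y \<in> Z" for y
    using prox_is_arg_min[OF assms(1,4,5)] that by (simp add: p_def is_arg_min_linorder)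
  have "eventually (\<lambda>s. ?c \<le> (\<omega> (?x s) - \<omega> p) / s) (at_right 0)"
    unfolding eventually_at_right_field
  proof (intro exI[of _ 1] conjI allI impI)
    fix s :: real assume s: "0 < s" "s < 1"
    have "?x s \<in> Z"
      using Z pZ assms(6) s by (simp add: convex_alt)
    have x: "?x s = p + s *\<^sub>R (u - p)"
      by (simp add: algebra_simps)
    have "J (?x s) \<le> (1 - s) * J p + s * J u"
      using convex_onD[OF assms(3), of s p u] pZ assms(6) s by simp
    then have "\<gamma> * J (?x s) \<le> \<gamma> * ((1 - s) * J p + s * J u)"
      using assms(5) by simp
    moreover have "0 \<le> \<eta> \<bullet> (?x s - p) + \<omega> (?x s) - \<omega> p - \<omega>' z \<bullet> (?x s - p) + \<gamma> * J (?x s) - \<gamma> * J p"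
      using min[OF \<open>?x s \<in> Z\<close>] by (simp add: prox_objective_def bregman_def inner_diff_right)
    ultimately have "s * ?c \<le> \<omega> (?x s) - \<omega> p"
      unfolding x by (simp add: algebra_simps)
    then show "?c \<le> (\<omega> (?x s) - \<omega> p) / s"
      using s by (simp add: pos_le_divide_eq mult.commute)
  qed simp
  then have "?c \<le> \<omega>' p \<bullet> (u - p)"
    using has_gradient_on_tendsto_quotient[OF assms(2) Z pZ assms(6)]
    by (intro tendsto_lowerbound[OF _ _ trivial_limit_at_right_real])
  \<comment> \<open>The right-hand side equals
    \<open>(\<omega>' p - \<omega>' z) \<bullet> (u - p)\<close>: all values of \<omega>
    cancel.\<close>
  then show ?thesis
    by (simp add: bregman_def algebra_simps)
qed

section \<open>Estimates for a single AMP step\<close>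

lemma extragradient_step:
  fixes \<omega> :: "'a::euclidean_space \<Rightarrow> real"
  assumes norm: "is_norm N"
    and \<omega>: "has_gradient_on \<omega> \<omega>' Z" "strongly_convex_on N \<mu> Z \<omega>" "0 < \<mu>"
    and J: "convex_on Z J"
    and wd: "prox_well_defined Z \<omega> \<omega>' J"
    and H: "\<And>u v. u \<in> Z \<Longrightarrow> v \<in> Z \<Longrightarrow> dual_norm N (H u - H v) \<le> L * N (u - v)"
    and \<gamma>: "0 < \<gamma>" and r: "r \<in> Z" and u: "u \<in> Z"
    and q_def: "q = prox Z \<omega> \<omega>' J \<gamma> r (\<gamma> *\<^sub>R H r + \<gamma> *\<^sub>R g)"
    and p_def: "p = prox Z \<omega> \<omega>' J \<gamma> r (\<gamma> *\<^sub>R H q + \<gamma> *\<^sub>R g)"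
  shows "\<gamma> * ((H q + g) \<bullet> (q - u) + J q - J u)
    \<le> bregman \<omega> \<omega>' r u - bregman \<omega> \<omega>' p u - (\<mu> - L\<^sup>2 * \<gamma>\<^sup>2 / \<mu>) / 2 * (N (q - r))\<^sup>2"
proof -
  let ?V = "bregman \<omega> \<omega>'"
  define a b where "a = N (q - r)" and "b = N (q - p)"
  have N0: "0 \<le> N x" and sc: "N (c *\<^sub>R x) = \<bar>c\<bar> * N x" for c x
    using norm unfolding is_norm_def by auto
  have a: "N (r - q) = a"
    using sc[of "-1" "q - r"] by (simp add: a_def)
  have qZ: "q \<in> Z" and pZ: "p \<in> Z"
    unfolding q_def p_def by (rule prox_in[OF wd r \<gamma>])+
  have "(\<gamma> *\<^sub>R H q + \<gamma> *\<^sub>R g) \<bullet> (p - u) + \<gamma> * (J p - J u) \<le> ?V r u - ?V p u - ?V r p"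
    by (rule prox_optimality[OF wd \<omega>(1) J r \<gamma> u p_def])
  \<comment> \<open>The first prox-step is tested at \<open>p\<close>, the result of the second, so
    that \<open>?V r p\<close> cancels in the sum.\<close>
  moreover have "(\<gamma> *\<^sub>R H r + \<gamma> *\<^sub>R g) \<bullet> (q - p) + \<gamma> * (J q - J p) \<le> ?V r p - ?V q p - ?V r q"
    by (rule prox_optimality[OF wd \<omega>(1) J r \<gamma> pZ q_def])
  moreover have "\<mu> / 2 * a\<^sup>2 \<le> ?V r q"
    using bregman_lower_bound[OF \<omega>(1,2) r qZ] by (simp add: a)
  moreover have "\<mu> / 2 * b\<^sup>2 \<le> ?V q p"
    using bregman_lower_bound[OF \<omega>(1,2) qZ pZ] by (simp add: b_def)
  moreover have "\<gamma> * ((H q - H r) \<bullet> (q - p)) \<le> \<mu> / 2 * b\<^sup>2 + L\<^sup>2 * \<gamma>\<^sup>2 / \<mu> / 2 * a\<^sup>2"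
  proof -
    have "(H q - H r) \<bullet> (q - p) \<le> dual_norm N (H q - H r) * b"
      unfolding b_def by (rule inner_le_dual_norm[OF norm])
    also have "\<dots> \<le> L * a * b"
      unfolding a_def b_def using H[OF qZ r] N0 by (rule mult_right_mono)
    finally have "\<gamma> * ((H q - H r) \<bullet> (q - p)) \<le> \<gamma> * (L * a * b)"
      using \<gamma> by simp
    \<comment> \<open>Young's inequality, weighted so that the coefficient of
      \<open>b\<^sup>2\<close> is exactly the one that strong convexity gives for
      \<open>?V q p\<close>; the distance from \<open>q\<close> to \<open>p\<close> thus drops
      out.\<close>
    moreover have "0 \<le> (\<mu> * b - L * \<gamma> * a)\<^sup>2 / (2 * \<mu>)"
      using \<omega>(3) by simp
    then have "\<gamma> * (L * a * b) \<le> \<mu> / 2 * b\<^sup>2 + L\<^sup>2 * \<gamma>\<^sup>2 / \<mu> / 2 * a\<^sup>2"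
      using \<omega>(3) by (simp add: power2_eq_square field_simps)
    ultimately show ?thesis
      by linarith
  qed
  moreover have "\<gamma> * ((H q + g) \<bullet> (q - u) + J q - J u)
      = ((\<gamma> *\<^sub>R H q + \<gamma> *\<^sub>R g) \<bullet> (p - u) + \<gamma> * (J p - J u))
        + ((\<gamma> *\<^sub>R H r + \<gamma> *\<^sub>R g) \<bullet> (q - p) + \<gamma> * (J q - J p))
        + \<gamma> * ((H q - H r) \<bullet> (q - p))"
    by (simp add: algebra_simps)
  moreover have "(\<mu> - L\<^sup>2 * \<gamma>\<^sup>2 / \<mu>) / 2 * a\<^sup>2 = \<mu> / 2 * a\<^sup>2 - L\<^sup>2 * \<gamma>\<^sup>2 / \<mu> / 2 * a\<^sup>2"
    by (simp add: left_diff_distrib diff_divide_distrib)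
  ultimately show ?thesis
    unfolding a_def by linarith
qed

text \<open>Since \<open>m\<close> and \<open>y\<close> average with the same weight,
  \<open>y - m = \<alpha> *\<^sub>R (q - r)\<close>, which makes the smoothness error quadratic in
  \<alpha>. Convexity of \<open>G\<close> at \<open>m\<close> handles \<open>x\<close> and
  \<open>u\<close>, and monotonicity trades \<open>H u\<close> for \<open>H q\<close>.\<close>

lemma gap_Q_averaging_step:
  fixes G :: "'a::real_inner \<Rightarrow> real"
  assumes norm: "is_norm N" and Z: "convex Z"
    and G: "\<And>u v. u \<in> Z \<Longrightarrow> v \<in> Z \<Longrightarrow>
          0 \<le> G u - G v - G' v \<bullet> (u - v) \<and>
          G u - G v - G' v \<bullet> (u - v) \<le> L / 2 * (N (u - v))\<^sup>2"
    and H: "\<And>u v. u \<in> Z \<Longrightarrow> v \<in> Z \<Longrightarrow> 0 \<le> (H u - H v) \<bullet> (u - v)"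
    and J: "convex_on Z J"
    and mem: "x \<in> Z" "r \<in> Z" "q \<in> Z" "u \<in> Z"
    and \<alpha>: "0 \<le> \<alpha>" "\<alpha> \<le> 1"
    and m_def: "m = (1 - \<alpha>) *\<^sub>R x + \<alpha> *\<^sub>R r"
    and y_def: "y = (1 - \<alpha>) *\<^sub>R x + \<alpha> *\<^sub>R q"
  shows "gap_Q G H J y u \<le> (1 - \<alpha>) * gap_Q G H J x u
    + \<alpha> * ((H q + G' m) \<bullet> (q - u) + J q - J u) + L / 2 * \<alpha>\<^sup>2 * (N (q - r))\<^sup>2"
proof -
  have mZ: "m \<in> Z" and yZ: "y \<in> Z"
    using Z mem \<alpha> by (simp_all add: m_def y_def convex_alt)
  have ym: "y - m = \<alpha> *\<^sub>R (q - r)"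
    by (simp add: m_def y_def algebra_simps)
  have "N (y - m) = \<alpha> * N (q - r)"
    using norm \<alpha> by (simp add: is_norm_def ym)
  then have 1: "G y \<le> G m + G' m \<bullet> (y - m) + L / 2 * \<alpha>\<^sup>2 * (N (q - r))\<^sup>2"
    using G[OF yZ mZ] by (simp add: power_mult_distrib algebra_simps)
  have 2: "(1 - \<alpha>) * (G m + G' m \<bullet> (x - m)) \<le> (1 - \<alpha>) * G x"
    using G[OF mem(1) mZ] \<alpha> by (intro mult_left_mono) auto
  have 3: "\<alpha> * (G m + G' m \<bullet> (u - m)) \<le> \<alpha> * G u"
    using G[OF mem(4) mZ] \<alpha> by (intro mult_left_mono) auto
  have 4: "J y \<le> (1 - \<alpha>) * J x + \<alpha> * J q"
    using convex_onD[OF J, of \<alpha> x q] mem \<alpha> by (simp add: y_def)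
  have 5: "\<alpha> * (H u \<bullet> (q - u)) \<le> \<alpha> * (H q \<bullet> (q - u))"
    using H[OF mem(3,4)] \<alpha> by (intro mult_left_mono) (auto simp: inner_diff_left)
  \<comment> \<open>The linearisation of \<open>G\<close> at \<open>m\<close> is affine, so it
    splits along \<open>y\<close>; its value at \<open>q\<close> is its value at \<open>u\<close>
    plus \<open>G' m \<bullet> (q - u)\<close>.\<close>
  have 6: "G m + G' m \<bullet> (y - m) = (1 - \<alpha>) * (G m + G' m \<bullet> (x - m))
      + \<alpha> * (G m + G' m \<bullet> (u - m)) + \<alpha> * (G' m \<bullet> (q - u))"
    by (simp add: y_def algebra_simps)
  have 7: "H u \<bullet> (y - u) = (1 - \<alpha>) * (H u \<bullet> (x - u)) + \<alpha> * (H u \<bullet> (q - u))"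
    by (simp add: y_def algebra_simps)
  have "gap_Q G H J y u \<le> (1 - \<alpha>) * G x + \<alpha> * G u + \<alpha> * (G' m \<bullet> (q - u))
      + L / 2 * \<alpha>\<^sup>2 * (N (q - r))\<^sup>2 - G u
      + (1 - \<alpha>) * (H u \<bullet> (x - u)) + \<alpha> * (H q \<bullet> (q - u)) + (1 - \<alpha>) * J x + \<alpha> * J q - J u"
    unfolding gap_Q_def using 1 2 3 4 5 6 7 by linarith
  also have "\<dots> = (1 - \<alpha>) * gap_Q G H J x u
    + \<alpha> * ((H q + G' m) \<bullet> (q - u) + J q - J u) + L / 2 * \<alpha>\<^sup>2 * (N (q - r))\<^sup>2"
    by (simp add: gap_Q_def algebra_simps)
  finally show ?thesis .
qed

section \<open>Summing the recursion\<close>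

lemma weighted_telescope:
  fixes q V \<alpha> \<gamma> \<Gamma> :: "nat \<Rightarrow> real"
  assumes step: "\<And>t. 1 \<le> t \<Longrightarrow> q (t + 1) \<le> (1 - \<alpha> t) * q t + \<alpha> t / \<gamma> t * (V t - V (t + 1))"
    and V: "\<And>t. 1 \<le> t \<Longrightarrow> 0 \<le> V t \<and> V t \<le> D"
    and \<gamma>: "\<And>t. 1 \<le> t \<Longrightarrow> 0 < \<gamma> t"
    and \<alpha>: "\<alpha> 1 = 1" "\<And>t. 1 < t \<Longrightarrow> 0 \<le> \<alpha> t \<and> \<alpha> t < 1"
    and \<Gamma>: "\<Gamma> 1 = 1" "\<And>t. 1 < t \<Longrightarrow> \<Gamma> t = (1 - \<alpha> t) * \<Gamma> (t - 1)"
    and ratio: "\<And>t. 1 \<le> t \<Longrightarrow> \<alpha> t / (\<Gamma> t * \<gamma> t) \<le> \<alpha> (t + 1) / (\<Gamma> (t + 1) * \<gamma> (t + 1))"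
    and "1 \<le> t"
  shows "q (t + 1) \<le> \<alpha> t / \<gamma> t * D"
proof -
  have \<Gamma>_pos: "0 < \<Gamma> t" if "1 \<le> t" for t
    using that
  proof (induction t rule: dec_induct)
    case (step n)
    then show ?case
      using \<alpha>(2)[of "Suc n"] \<Gamma>(2)[of "Suc n"] by simp
  qed (use \<Gamma>(1) in simp)
  define c where "c t = \<alpha> t / (\<Gamma> t * \<gamma> t)" for t
  \<comment> \<open>Keeping \<open>V (t + 1)\<close> in the bound replaces summation by parts: as
    \<open>D - V\<close> is nonnegative, the old weight can be raised to the new one, after which
    the \<open>V\<close> terms telescope.\<close>
  have "q (t + 1) / \<Gamma> t \<le> c t * (D - V (t + 1))"
    using \<open>1 \<le> t\<close>
  proof (induction t rule: dec_induct)
    case base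
    \<comment> \<open>At the first index \<open>\<alpha> 1 = 1\<close> removes \<open>q 1\<close>,
      so the bound does not involve the gap at the starting point.\<close>
    have "0 < \<gamma> 1" "V 1 \<le> D"
      using \<gamma> V by auto
    then have "(V 1 - V 2) / \<gamma> 1 \<le> (D - V 2) / \<gamma> 1"
      by (intro divide_right_mono) auto
    then show ?case
      using step[of 1] \<alpha>(1) \<Gamma>(1) by (simp add: c_def numeral_2_eq_2)
  next
    case (step n)
    let ?n = "Suc n"
    have pos: "0 < \<Gamma> n" "0 < \<Gamma> ?n" "0 < \<gamma> ?n"
      using \<Gamma>_pos \<gamma> step.hyps by auto
    have rec: "\<Gamma> ?n = (1 - \<alpha> ?n) * \<Gamma> n"
      using \<Gamma>(2)[of ?n] step.hyps by simp
    then have "1 - \<alpha> ?n \<noteq> 0"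
      using pos by auto
    have "q (?n + 1) / \<Gamma> ?n \<le> ((1 - \<alpha> ?n) * q ?n + \<alpha> ?n / \<gamma> ?n * (V ?n - V (?n + 1))) / \<Gamma> ?n"
      using assms(1)[of ?n] pos by (intro divide_right_mono) auto
    also have "\<dots> = q ?n / \<Gamma> n + c ?n * (V ?n - V (?n + 1))"
    proof -
      have "(1 - \<alpha> ?n) * q ?n / \<Gamma> ?n = q ?n / \<Gamma> n"
        using \<open>1 - \<alpha> ?n \<noteq> 0\<close> by (simp add: rec)
      moreover have "\<alpha> ?n / \<gamma> ?n * (V ?n - V (?n + 1)) / \<Gamma> ?n = c ?n * (V ?n - V (?n + 1))"
        by (simp add: c_def mult.commute)
      ultimately show ?thesis
        by (simp add: add_divide_distrib)
    qed
    also have "\<dots> \<le> c n * (D - V ?n) + c ?n * (V ?n - V (?n + 1))"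
      using step.IH by simp
    also have "\<dots> \<le> c ?n * (D - V ?n) + c ?n * (V ?n - V (?n + 1))"
      using ratio[of n] V[of ?n] step.hyps by (intro add_right_mono mult_right_mono) (auto simp: c_def)
    also have "\<dots> = c ?n * (D - V (?n + 1))"
      by (simp add: algebra_simps)
    finally show ?case .
  qed
  also have "\<dots> \<le> c t * D"
  proof (rule mult_left_mono)
    show "D - V (t + 1) \<le> D"
      using V[of "t + 1"] by simp
    have "0 \<le> \<alpha> t"
      using \<alpha> \<open>1 \<le> t\<close> by (cases "t = 1") auto
    then show "0 \<le> c t"
      using \<Gamma>_pos[OF \<open>1 \<le> t\<close>] \<gamma>[OF \<open>1 \<le> t\<close>] by (simp add: c_def)
  qed
  finally have "q (t + 1) \<le> c t * D * \<Gamma> t"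
    using \<Gamma>_pos[OF \<open>1 \<le> t\<close>] by (simp add: pos_divide_le_eq)
  then show ?thesis
    using \<Gamma>_pos[OF \<open>1 \<le> t\<close>] by (simp add: c_def)
qed

section \<open>The gap bound for the AMP iterates\<close>

theorem theorem2p1:
  fixes Z :: "'a::euclidean_space set"
    and N :: "'a \<Rightarrow> real"
    and G J \<omega> :: "'a \<Rightarrow> real"
    and G' H \<omega>' :: "'a \<Rightarrow> 'a"
    and L\<^sub>G L\<^sub>H \<mu> \<Omega> :: real
    and \<alpha> \<gamma> \<Gamma> :: "nat \<Rightarrow> real"
    and r w w_ag w_md :: "nat \<Rightarrow> 'a"
  assumes norm: "is_norm N"
    and Z: "Z \<noteq> {}" "closed Z" "convex Z"
    and G_C1: "has_gradient_on G G' Z" "continuous_on Z G'"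
    and G_bounds: "\<And>u v. u \<in> Z \<Longrightarrow> v \<in> Z \<Longrightarrow>
          0 \<le> G u - G v - G' v \<bullet> (u - v) \<and>
          G u - G v - G' v \<bullet> (u - v) \<le> L\<^sub>G / 2 * (N (u - v))\<^sup>2"
    and H_mono: "\<And>u v. u \<in> Z \<Longrightarrow> v \<in> Z \<Longrightarrow> 0 \<le> (H u - H v) \<bullet> (u - v)"
    and H_lipschitz: "\<And>u v. u \<in> Z \<Longrightarrow> v \<in> Z \<Longrightarrow> dual_norm N (H u - H v) \<le> L\<^sub>H * N (u - v)"
    and J_convex: "convex_on Z J"
    and J_subgradient: "\<And>u. u \<in> Z \<Longrightarrow> subdifferential Z J u \<noteq> {}"
    and \<mu>_pos: "0 < \<mu>"
    and \<omega>_diff: "has_gradient_on \<omega> \<omega>' Z"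
    and \<omega>_strongly_convex: "strongly_convex_on N \<mu> Z \<omega>"
    and prox_wd: "prox_well_defined Z \<omega> \<omega>' J"
    and V_bound: "(SUP (z\<^sub>1, z\<^sub>2)\<in>Z \<times> Z. ereal (bregman \<omega> \<omega>' z\<^sub>1 z\<^sub>2)) \<le> ereal (\<Omega>\<^sup>2)"
    and \<gamma>_pos: "\<And>t. t \<ge> 1 \<Longrightarrow> 0 < \<gamma> t"
    and \<alpha>_1: "\<alpha> 1 = 1"
    and \<alpha>_range: "\<And>t. t > 1 \<Longrightarrow> 0 \<le> \<alpha> t \<and> \<alpha> t < 1"
    and \<Gamma>_1: "\<Gamma> 1 = 1"
    and \<Gamma>_rec: "\<And>t. t > 1 \<Longrightarrow> \<Gamma> t = (1 - \<alpha> t) * \<Gamma> (t - 1)"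
    and step_cond: "\<And>t. t \<ge> 1 \<Longrightarrow>
          0 \<le> \<mu> - L\<^sub>G * \<alpha> t * \<gamma> t - L\<^sub>H\<^sup>2 * (\<gamma> t)\<^sup>2 / \<mu>"
    and ratio_cond: "\<And>t. t \<ge> 1 \<Longrightarrow>
          \<alpha> t / (\<Gamma> t * \<gamma> t) \<le> \<alpha> (t + 1) / (\<Gamma> (t + 1) * \<gamma> (t + 1))"
    and iterates: "amp_iterates Z G' H J \<omega> \<omega>' \<alpha> \<gamma> r w w_ag w_md"
  shows "\<forall>t\<ge>1. gap Z G H J (w_ag (t + 1)) \<le> ereal (\<alpha> t / \<gamma> t * \<Omega>\<^sup>2)"
proof (intro allI impI)
  fix t :: nat
  assume "1 \<le> t"
  let ?V = "bregman \<omega> \<omega>'"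
  have w: "w (t + 1) = prox Z \<omega> \<omega>' J (\<gamma> t) (r t) (\<gamma> t *\<^sub>R H (r t) + \<gamma> t *\<^sub>R G' (w_md t))"
    and r: "r (t + 1) = prox Z \<omega> \<omega>' J (\<gamma> t) (r t) (\<gamma> t *\<^sub>R H (w (t + 1)) + \<gamma> t *\<^sub>R G' (w_md t))"
    and md: "w_md t = (1 - \<alpha> t) *\<^sub>R w_ag t + \<alpha> t *\<^sub>R r t"
    and ag: "w_ag (t + 1) = (1 - \<alpha> t) *\<^sub>R w_ag t + \<alpha> t *\<^sub>R w (t + 1)" if "1 \<le> t" for t
    using iterates that unfolding amp_iterates_def by blast+
  have init: "r 1 \<in> Z" "w_ag 1 = r 1"
    using iterates unfolding amp_iterates_def by blast+
  have \<alpha>01: "0 \<le> \<alpha> t \<and> \<alpha> t \<le> 1" if "1 \<le> t" for t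
    using that \<alpha>_1 \<alpha>_range[of t] by (cases "t = 1") auto
  have mem: "r t \<in> Z \<and> w_ag t \<in> Z" if "1 \<le> t" for t
    using that
  proof (induction t rule: dec_induct)
    case (step n)
    have "r (n + 1) \<in> Z" "w (n + 1) \<in> Z"
      using step prox_in[OF prox_wd] \<gamma>_pos by (simp_all add: r w del: One_nat_def)
    moreover from this have "w_ag (n + 1) \<in> Z"
      using step Z(3) \<alpha>01[of n] unfolding ag[OF step.hyps(1)] by (simp add: convex_alt)
    ultimately show ?case
      by simp
  qed (use init in auto)
  have w_mem: "w (t + 1) \<in> Z" if "1 \<le> t" for t
    unfolding w[OF that] using that mem prox_in[OF prox_wd] \<gamma>_pos by simp
  \<comment> \<open>The comparison point \<open>u\<close> stays fixed through the whole recursion;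
    the supremum is taken only at the end.\<close>
  have "gap_Q G H J (w_ag (t + 1)) u \<le> \<alpha> t / \<gamma> t * \<Omega>\<^sup>2" if u: "u \<in> Z" for u
  proof (rule weighted_telescope[where q = "\<lambda>t. gap_Q G H J (w_ag t) u" and V = "\<lambda>t. ?V (r t) u",
        OF _ _ \<gamma>_pos \<alpha>_1 \<alpha>_range \<Gamma>_1 \<Gamma>_rec ratio_cond \<open>1 \<le> t\<close>])
    fix t :: nat
    assume t: "1 \<le> t"
    show "0 \<le> ?V (r t) u \<and> ?V (r t) u \<le> \<Omega>\<^sup>2"
    proof
      have "0 \<le> \<mu> / 2 * (N (r t - u))\<^sup>2"
        using \<mu>_pos by simp
      then show "0 \<le> ?V (r t) u"
        using bregman_lower_bound[OF \<omega>_diff \<omega>_strongly_convex, of "r t" u] mem[OF t] u by linarith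
      have "ereal (?V (r t) u) \<le> ereal (\<Omega>\<^sup>2)"
        by (rule order_trans[OF SUP_upper2[of "(r t, u)"] V_bound]) (use mem[OF t] u in auto)
      then show "?V (r t) u \<le> \<Omega>\<^sup>2"
        by simp
    qed
    let ?E = "(H (w (t + 1)) + G' (w_md t)) \<bullet> (w (t + 1) - u) + J (w (t + 1)) - J u"
    let ?n = "(N (w (t + 1) - r t))\<^sup>2"
    let ?d = "?V (r t) u - ?V (r (t + 1)) u"
    have \<gamma>: "0 < \<gamma> t"
      using \<gamma>_pos[OF t] .
    have "\<gamma> t * ?E \<le> ?d - (\<mu> - L\<^sub>H\<^sup>2 * (\<gamma> t)\<^sup>2 / \<mu>) / 2 * ?n"
      using extragradient_step[OF norm \<omega>_diff \<omega>_strongly_convex \<mu>_pos J_convex prox_wd H_lipschitz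
          \<gamma> _ u w[OF t] r[OF t]] mem[OF t] by blast
    \<comment> \<open>The step-size condition says that the available coefficient is at least
      \<open>L\<^sub>G * \<alpha> t * \<gamma> t\<close>; multiplied by
      \<open>\<alpha> t / \<gamma> t\<close>, this becomes exactly the smoothness error of the
      averaging step.\<close>
    also have "\<dots> \<le> ?d - L\<^sub>G * \<alpha> t * \<gamma> t / 2 * ?n"
      using step_cond[OF t] by (intro diff_left_mono mult_right_mono) auto
    finally have "?E \<le> (?d - L\<^sub>G * \<alpha> t * \<gamma> t / 2 * ?n) / \<gamma> t"
      using \<gamma> by (simp add: pos_le_divide_eq mult.commute)
    then have "\<alpha> t * ?E \<le> \<alpha> t * ((?d - L\<^sub>G * \<alpha> t * \<gamma> t / 2 * ?n) / \<gamma> t)"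
      using \<alpha>01[OF t] by (intro mult_left_mono) auto
    also have "\<dots> = \<alpha> t / \<gamma> t * ?d - L\<^sub>G / 2 * (\<alpha> t)\<^sup>2 * ?n"
      using \<gamma> by (simp add: field_simps power2_eq_square)
    finally show "gap_Q G H J (w_ag (t + 1)) u
        \<le> (1 - \<alpha> t) * gap_Q G H J (w_ag t) u + \<alpha> t / \<gamma> t * ?d"
      using gap_Q_averaging_step[OF norm Z(3) G_bounds H_mono J_convex _ _ w_mem[OF t] u _ _
          md[OF t] ag[OF t]] mem[OF t] \<alpha>01[OF t] by fastforce
  qed
  then show "gap Z G H J (w_ag (t + 1)) \<le> ereal (\<alpha> t / \<gamma> t * \<Omega>\<^sup>2)"
    unfolding gap_def by (intro SUP_least) simp
qed

end
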